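(* Let $\mathbf{U}_j$, $j\ge1$, be the orthonormal bases produced without breakdown by the rational Krylov method applied to the pencil $\mathcal{A}-\lambda\mathcal{B}$, where $$\mathcal{A}=\left[\begin{array}{cccc|c}P_{d-1}&P_{d-2}&\cdots&P_0&E\\ -I_n&0&\cdots&0&\\ &\ddots&\ddots&\vdots&\\ &&-I_n&0&\\ \hline &&&F^T&C\end{array}\right],\qquad \mathcal{B}=-\left[\begin{array}{cccc|c}P_d&&&&\\ &I_n&&&\\ &&\ddots&&\\ &&&I_n&\\ \hline &&&&-D\end{array}\right],$$ and partition $$\mathbf{U}_j=\begin{bmatrix}U_j^{(1)}\\ \vdots\\ U_j^{(d)}\\ V_j\end{bmatrix},\qquad U_j^{(i)}\in\mathbb{C}^{n\times j},\ V_j\in\mathbb{C}^{s\times j}.$$ Let $Q_j\in\mathbb{C}^{n\times r_j}$ be a matrix with orthonormal columns, of rank $r_j$, such that $$\mathrm{span}\{Q_j\}=\mathrm{span}\{U_j^{(1)},U_j^{(2)},\dots,U_j^{(d)}\}.$$ Then $$r_j<d+j.$$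
   Context: The span of a collection of matrices with $n$ rows means the subspace of $\mathbb{C}^n$ spanned by all their columns. Setting: $R(\lambda)=P(\lambda)-E(C-\lambda D)^{-1}F^T\in\mathbb{C}(\lambda)^{n\times n}$ with $P(\lambda)=\sum_{i=0}^d\lambda^iP_i$, $P_i\in\mathbb{C}^{n\times n}$, $E,F\in\mathbb{C}^{n\times s}$, $C,D\in\mathbb{C}^{s\times s}$. Standing assumptions: $\det R(\lambda)\not\equiv0$, $P_d$ is nonsingular, $D$ is nonsingular, and the realization $E(C-\lambda D)^{-1}F^T$ is minimal, i.e., $\begin{bmatrix}C-\lambda D\\ E\end{bmatrix}$ and $[\,C-\lambda D\quad F^T\,]$ both have rank $s$ for every $\lambda\in\mathbb{C}$. Rational Krylov method: given $\mathbf{u}_1\in\mathbb{C}^{nd+s}$ with $\|\mathbf{u}_1\|_2=1$, set $\mathbf{U}_1=[\mathbf{u}_1]$. For $j=1,2,\dots$, choose a shift $\theta_j\in\mathbb{C}$ (with $\mathcal{A}-\theta_j\mathcal{B}$ nonsingular), compute $\mathbf{\hat u}=(\mathcal{A}-\theta_j\mathcal{B})^{-1}\mathcal{B}\mathbf{u}_j$, $h_j=\mathbf{U}_j^*\mathbf{\hat u}$, $\mathbf{\tilde u}=\mathbf{\hat u}-\mathbf{U}_jh_j$, $h_{j+1,j}=\|\mathbf{\tilde u}\|_2$, $\mathbf{u}_{j+1}=\mathbf{\tilde u}/h_{j+1,j}$, and set $\mathbf{U}_{j+1}=[\mathbf{U}_j\quad\mathbf{u}_{j+1}]$. No breakdown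 means $h_{j+1,j}\neq0$ for all $j$ considered (a standing assumption). *)

theory Defs
  imports
    "HOL-Computational_Algebra.Polynomial_Factorial"
    "Jordan_Normal_Form.Schur_Decomposition"
    "Jordan_Normal_Form.Gauss_Jordan_Elimination"
    "Jordan_Normal_Form.DL_Rank"
begin

definition append_cols :: "'a::zero mat \<Rightarrow> 'a mat \<Rightarrow> 'a mat" where
  "append_cols A B = four_block_mat A B (0\<^sub>m 0 (dim_col A)) (0\<^sub>m 0 (dim_col B))"

(* The partial function mat_inverse, used only on nonsingular matrices. *)
definition minv :: "'a::field mat \<Rightarrow> 'a mat" where
  "minv A = the (mat_inverse A)"

definition vec_norm2 :: "complex vec \<Rightarrow> real" where
  "vec_norm2 v = sqrt (\<Sum>i<dim_vec v. (cmod (v $ i))\<^sup>2)"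

(* The subspace of C^n spanned by all columns of all matrices in Ms. *)
definition mats_span :: "nat \<Rightarrow> complex mat set \<Rightarrow> complex vec set" where
  "mats_span n Ms =
     LinearCombinations.module.span class_ring (module_vec TYPE(complex) n) (\<Union>M\<in>Ms. set (cols M))"


(* The field C(lambda) of rational functions is complex poly fract, and R(lambda) is a
   matrix over this field. *)

definition rf_const :: "complex \<Rightarrow> complex poly fract" where
  "rf_const c = to_fract [:c:]"

definition rf_var :: "complex poly fract" where
  "rf_var = to_fract [:0, 1:]"

definition poly_part :: "nat \<Rightarrow> nat \<Rightarrow> (nat \<Rightarrow> complex mat) \<Rightarrow> complex poly fract mat" where
  "poly_part n d P = mat n n (\<lambda>(a, b). \<Sum>i\<le>d. rf_var ^ i * rf_const (P i $$ (a, b)))"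

definition rational_matrix ::
  "nat \<Rightarrow> nat \<Rightarrow> (nat \<Rightarrow> complex mat) \<Rightarrow> complex mat \<Rightarrow> complex mat \<Rightarrow> complex mat \<Rightarrow> complex mat
    \<Rightarrow> complex poly fract mat" where
  "rational_matrix n d P E F C D =
     poly_part n d P
     - map_mat rf_const E
       * minv (map_mat rf_const C - rf_var \<cdot>\<^sub>m map_mat rf_const D)
       * (map_mat rf_const F)\<^sup>T"

definition minimal_realization ::
  "nat \<Rightarrow> nat \<Rightarrow> complex mat \<Rightarrow> complex mat \<Rightarrow> complex mat \<Rightarrow> complex mat \<Rightarrow> bool" where
  "minimal_realization n s E F C D \<longleftrightarrow>
     (\<forall>z::complex. vec_space.rank (s + n) ((C - z \<cdot>\<^sub>m D) @\<^sub>r E) = s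
                 \<and> vec_space.rank s (append_cols (C - z \<cdot>\<^sub>m D) F\<^sup>T) = s)"


(* The d x d block matrix with n x n blocks B k l, where k and l run from 1 to d. *)
definition block_mat :: "nat \<Rightarrow> nat \<Rightarrow> (nat \<Rightarrow> nat \<Rightarrow> complex mat) \<Rightarrow> complex mat" where
  "block_mat n d B =
     mat (n * d) (n * d) (\<lambda>(a, b). B (a div n + 1) (b div n + 1) $$ (a mod n, b mod n))"

definition pencil_A ::
  "nat \<Rightarrow> nat \<Rightarrow> nat \<Rightarrow> (nat \<Rightarrow> complex mat) \<Rightarrow> complex mat \<Rightarrow> complex mat \<Rightarrow> complex mat \<Rightarrow> complex mat" where
  "pencil_A n s d P E F C =
     four_block_mat
       (block_mat n d (\<lambda>k l. if k = 1 then P (d - l) else if k = l + 1 then - 1\<^sub>m n else 0\<^sub>m n n))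
       (E @\<^sub>r 0\<^sub>m (n * (d - 1)) s)
       (append_cols (0\<^sub>m s (n * (d - 1))) F\<^sup>T)
       C"

definition pencil_B ::
  "nat \<Rightarrow> nat \<Rightarrow> nat \<Rightarrow> (nat \<Rightarrow> complex mat) \<Rightarrow> complex mat \<Rightarrow> complex mat" where
  "pencil_B n s d P D =
     - four_block_mat
         (block_mat n d (\<lambda>k l. if k \<noteq> l then 0\<^sub>m n n else if k = 1 then P d else 1\<^sub>m n))
         (0\<^sub>m (n * d) s)
         (0\<^sub>m s (n * d))
         (- D)"


definition basis_mat :: "nat \<Rightarrow> (nat \<Rightarrow> complex vec) \<Rightarrow> nat \<Rightarrow> complex mat" where
  "basis_mat N u j = mat_of_cols N (map u [1..<Suc j])"

(* u 1, ..., u m are the vectors produced, with shifts theta 1, ..., theta (m - 1), by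
   m - 1 steps of the rational Krylov method without breakdown; the values of u outside
   {1..m} and of theta outside {1..<m} are irrelevant. *)
definition rational_krylov ::
  "complex mat \<Rightarrow> complex mat \<Rightarrow> (nat \<Rightarrow> complex) \<Rightarrow> nat \<Rightarrow> (nat \<Rightarrow> complex vec) \<Rightarrow> bool" where
  "rational_krylov A B \<theta> m u \<longleftrightarrow>
     u 1 \<in> carrier_vec (dim_row A) \<and> vec_norm2 (u 1) = 1 \<and>
     (\<forall>j\<in>{1..<m}.
        invertible_mat (A - \<theta> j \<cdot>\<^sub>m B) \<and>
        (let U = basis_mat (dim_row A) u j;
             uhat = minv (A - \<theta> j \<cdot>\<^sub>m B) *\<^sub>v (B *\<^sub>v u j);
             h = mat_adjoint U *\<^sub>v uhat;
             utilde = uhat - U *\<^sub>v h;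
             hnext = vec_norm2 utilde
         in hnext \<noteq> 0 \<and> u (j + 1) = complex_of_real (1 / hnext) \<cdot>\<^sub>v utilde))"

(* The n x j blocks U^(1), ..., U^(d) of U; the trailing s rows form the block V. *)
definition row_block :: "nat \<Rightarrow> complex mat \<Rightarrow> nat \<Rightarrow> complex mat" where
  "row_block n U i = mat n (dim_col U) (\<lambda>(a, b). U $$ ((i - 1) * n + a, b))"

end

theory Submission
  imports Defs
begin

text \<open>
  The \<open>d\<close> blocks \<open>x\<^sub>1, \<dots>, x\<^sub>d\<close> of a vector, all lying in \<open>\<complex>\<^sup>n\<close>, are tied together by the
  companion structure of the pencil. Block row \<open>i + 1\<close> of \<open>A\<close> is \<open>-I\<close> in block column \<open>i\<close>, and
  block row \<open>i + 1\<close> of \<open>B\<close> is \<open>-I\<close> on the diagonal; hence \<open>(A - t B) x = B w\<close> says there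
  \<open>x\<^sub>i = t x\<^sub>i\<^sub>+\<^sub>1 + w\<^sub>i\<^sub>+\<^sub>1\<close> (lemma \<open>shifted_solve_block_recurrence\<close>). If the blocks of \<open>w\<close> lie in a
  subspace \<open>W\<close>, then descending from \<open>x\<^sub>d\<close> puts every block of \<open>x\<close> into \<open>W\<close> enlarged by the single
  vector \<open>x\<^sub>d\<close> (lemma \<open>shifted_solve_blocks_in_vspan\<close>).

  In a Krylov step \<open>w\<close> is the last basis vector. Orthogonalizing and normalizing \<open>x\<close> subtracts earlier
  basis vectors and rescales, which on the level of blocks stays inside the same enlarged subspace.
  So the blocks of the first basis vector span at most \<open>d\<close> dimensions and each of the
  following \<open>j - 1\<close> steps adds at most one (lemma \<open>krylov_blocks_spanning_set\<close>), which gives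
  \<open>r \<le> d + (j - 1)\<close>.
\<close>

section \<open>Linear algebra\<close>

abbreviation vspan :: "nat \<Rightarrow> complex vec set \<Rightarrow> complex vec set" where
  "vspan n \<equiv> LinearCombinations.module.span class_ring (module_vec TYPE(complex) n)"

text \<open>
  A maximal independent set of columns has \<open>rank\<close> many elements, and by the replacement theorem
  an independent subset of a span is no larger than the spanning set.
\<close>

lemma rank_le_card_spanning_set:
  fixes Q :: "complex mat"
  assumes Q: "Q \<in> carrier_mat n r" and S: "finite S" "S \<subseteq> carrier_vec n"
    and sub: "set (cols Q) \<subseteq> vspan n S"
  shows "vec_space.rank n Q \<le> card S"
proof -
  interpret vec_space "TYPE(complex)" n .
  obtain B where B: "maximal B (\<lambda>T. T \<subseteq> set (cols Q) \<and> lin_indpt T)"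
    using maximal_exists_superset[of "set (cols Q)" "\<lambda>T. T \<subseteq> set (cols Q) \<and> lin_indpt T" "{}"]
    by (auto simp: lin_dep_def)
  then have "B \<subseteq> set (cols Q)" "lin_indpt B"
    by (auto simp: maximal_def)
  moreover from this have "finite B"
    by (simp add: finite_subset)
  ultimately have "\<exists>C :: complex vec set. int (card C) \<le> int (card S) - int (card B)"
    using replacement[of B S] S sub by (metis order_trans)
  then have "card B \<le> card S"
    by (metis diff_ge_0_iff_ge of_nat_0_le_iff of_nat_le_iff order_trans)
  then show ?thesis
    using rank_card_indpt[OF Q B] by simp
qed

lemma minv_right_inverse:
  fixes M :: "'a::field mat"
  assumes M: "M \<in> carrier_mat N N" and inv: "invertible_mat M"
  shows "minv M \<in> carrier_mat N N" and "M * minv M = 1\<^sub>m N"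
proof -
  obtain B where B: "M * B = 1\<^sub>m N" "B * M = 1\<^sub>m (dim_row B)"
    using inv M by (auto simp: invertible_mat_def inverts_mat_def)
  have dB: "B \<in> carrier_mat N N"
    using B M by (metis carrier_mat_triv carrier_matD(2) index_mult_mat(3) index_one_mat(3))
  have "M \<in> Units (ring_mat TYPE('a) N ())"
    using B dB M by (auto simp: Units_def ring_mat_def)
  then obtain I where "mat_inverse M = Some I"
    using mat_inverse(1)[OF M, where b = "()"] by (cases "mat_inverse M") auto
  then show "minv M \<in> carrier_mat N N" "M * minv M = 1\<^sub>m N"
    using mat_inverse(2)[OF M] by (auto simp: minv_def)
qed

section \<open>Blocks of a vector\<close>

text \<open>
  The numbering from 1 matches \<^const>\<open>row_block\<close>, so that the \<open>i\<close>-th row block of a matrix has the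
  \<open>i\<close>-th blocks of its columns as columns.
\<close>

definition vec_block :: "nat \<Rightarrow> nat \<Rightarrow> complex vec \<Rightarrow> complex vec" where
  "vec_block n i v = vec n (\<lambda>a. v $ ((i - 1) * n + a))"

lemma vec_block_carrier [simp]: "vec_block n i v \<in> carrier_vec n"
  by (simp add: vec_block_def)

lemma block_index_less:
  fixes i d a n :: nat
  assumes "i \<in> {1..d}" "a < n"
  shows "(i - 1) * n + a < n * d"
proof -
  have "(i - 1) * n + a < (i - 1) * n + n"
    using assms by simp
  also have "\<dots> = i * n"
    using assms by (cases i) auto
  also have "\<dots> \<le> n * d"
    using assms by (simp add: mult.commute)
  finally show ?thesis .
qed

lemma vec_block_smult:
  assumes "v \<in> carrier_vec (n * d + s)" "i \<in> {1..d}"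
  shows "vec_block n i (c \<cdot>\<^sub>v v) = c \<cdot>\<^sub>v vec_block n i v"
  using assms block_index_less[of i d _ n] by (intro eq_vecI) (auto simp: vec_block_def trans_less_add1)

lemma vec_block_minus:
  assumes "v \<in> carrier_vec (n * d + s)" "w \<in> carrier_vec (n * d + s)" "i \<in> {1..d}"
  shows "vec_block n i (v - w) = vec_block n i v - vec_block n i w"
  using assms block_index_less[of i d _ n] by (intro eq_vecI) (auto simp: vec_block_def trans_less_add1)

lemma col_row_block:
  assumes "U \<in> carrier_mat (n * d + s) k" "i \<in> {1..d}" "c < k"
  shows "col (row_block n U i) c = vec_block n i (col U c)"
  using assms block_index_less[of i d _ n]
  by (intro eq_vecI) (auto simp: vec_block_def row_block_def trans_less_add1)

lemma set_cols_row_block: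
  assumes "U \<in> carrier_mat (n * d + s) k" "i \<in> {1..d}"
  shows "set (cols (row_block n U i)) = vec_block n i ` set (cols U)"
proof -
  have "dim_col (row_block n U i) = k" "dim_col U = k"
    using assms by (auto simp: row_block_def)
  then show ?thesis
    using col_row_block[OF assms] by (auto simp: cols_def image_image)
qed

lemma vec_block_mult_mat_vec:
  assumes "U \<in> carrier_mat (n * d + s) k" "i \<in> {1..d}" "h \<in> carrier_vec k"
  shows "vec_block n i (U *\<^sub>v h) = row_block n U i *\<^sub>v h"
  using assms block_index_less[of i d _ n]
  by (intro eq_vecI)
    (auto simp: vec_block_def row_block_def trans_less_add1 scalar_prod_def intro!: sum.cong)

text \<open>
  Taking blocks is linear, so the block of a combination of basis vectors, such as the one that
  orthogonalization subtracts, is a combination of their blocks.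
\<close>

lemma vec_block_mult_in_vspan:
  assumes U: "U \<in> carrier_mat (n * d + s) k" and i: "i \<in> {1..d}" and h: "h \<in> carrier_vec k"
    and S: "S \<subseteq> carrier_vec n" and sub: "vec_block n i ` set (cols U) \<subseteq> vspan n S"
  shows "vec_block n i (U *\<^sub>v h) \<in> vspan n S"
proof -
  interpret vec_space "TYPE(complex)" n .
  have R: "row_block n U i \<in> carrier_mat n k"
    using U by (auto simp: row_block_def)
  have "row_block n U i *\<^sub>v h \<in> span (set (cols (row_block n U i)))"
    using col_space_eq[OF R] R h by (auto simp: col_space_def)
  also have "\<dots> \<subseteq> span S"
    using span_subsetI[OF S sub] by (simp add: set_cols_row_block[OF U i])
  finally show ?thesis
    by (simp add: vec_block_mult_mat_vec[OF U i h])
qed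

section \<open>The companion rows of the pencil\<close>

lemma pencil_A_carrier:
  assumes "d \<ge> 1" "E \<in> carrier_mat n s" "C \<in> carrier_mat s s"
  shows "pencil_A n s d P E F C \<in> carrier_mat (n * d + s) (n * d + s)"
  using assms by (auto simp: pencil_A_def block_mat_def)

lemma pencil_B_carrier:
  assumes "D \<in> carrier_mat s s"
  shows "pencil_B n s d P D \<in> carrier_mat (n * d + s) (n * d + s)"
  using assms by (auto simp: pencil_B_def block_mat_def)

text \<open>
  The bounds on \<open>a\<close> select the block rows \<open>2, \<dots>, d\<close>; the identity block one block column to the left
  of the diagonal becomes a shift of the scalar index by \<open>n\<close>.
\<close>

lemma row_pencil_A:
  assumes "d \<ge> 1" "E \<in> carrier_mat n s" "C \<in> carrier_mat s s"
    and a: "n \<le> a" "a < n * d"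
  shows "row (pencil_A n s d P E F C) a = - unit_vec (n * d + s) (a - n)"
proof (rule eq_vecI)
  show "dim_vec (row (pencil_A n s d P E F C) a) = dim_vec (- unit_vec (n * d + s) (a - n) :: complex vec)"
    using pencil_A_carrier[OF assms(1-3), of P F] by simp
  fix c assume "c < dim_vec (- unit_vec (n * d + s) (a - n) :: complex vec)"
  then have c: "c < n * d + s" by simp
  have npos: "n > 0" using a by (cases n) auto
  define b where "b = a - n"
  have b: "a = b + n" "b < n * d" using a by (auto simp: b_def)
  have div: "a div n = Suc (b div n)" and mod: "a mod n = b mod n"
    using npos by (auto simp: b(1))
  have eq: "b div n = c div n \<and> b mod n = c mod n \<longleftrightarrow> b = c"
    by (metis div_mult_mod_eq)
  have "pencil_A n s d P E F C $$ (a, c) = (if c = b then - 1 else 0)"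
  proof (cases "c < n * d")
    case True
    then show ?thesis
      using assms(2,3) a npos eq
      by (auto simp: pencil_A_def block_mat_def div mod)
  next
    case False
    then show ?thesis
      using assms(1-3) a c b(2) npos
      by (auto simp: pencil_A_def block_mat_def append_rows_def algebra_simps)
  qed
  then show "row (pencil_A n s d P E F C) a $ c = (- unit_vec (n * d + s) (a - n)) $ c"
    using pencil_A_carrier[OF assms(1-3), of P F] a c b(2) by (auto simp: b_def unit_vec_def)
qed

lemma row_pencil_B:
  assumes D: "D \<in> carrier_mat s s" and a: "n \<le> a" "a < n * d"
  shows "row (pencil_B n s d P D) a = - unit_vec (n * d + s) a"
proof (rule eq_vecI)
  show "dim_vec (row (pencil_B n s d P D) a) = dim_vec (- unit_vec (n * d + s) a :: complex vec)"
    using pencil_B_carrier[OF D, of n d P] by simp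
  fix c assume "c < dim_vec (- unit_vec (n * d + s) a :: complex vec)"
  then have c: "c < n * d + s" by simp
  have npos: "n > 0" using a by (cases n) auto
  have div: "a div n \<noteq> 0" using a npos by (simp add: div_eq_0_iff)
  have eq: "a div n = c div n \<and> a mod n = c mod n \<longleftrightarrow> a = c"
    by (metis div_mult_mod_eq)
  have "pencil_B n s d P D $$ (a, c) = (if c = a then - 1 else 0)"
    using D a c npos div eq
    by (cases "c < n * d") (auto simp: pencil_B_def block_mat_def)
  then show "row (pencil_B n s d P D) a $ c = (- unit_vec (n * d + s) a) $ c"
    using pencil_B_carrier[OF D, of n d P] a c by (auto simp: unit_vec_def)
qed

text \<open>Scalar row \<open>a = i * n + k\<close> of the linear system is entry \<open>k\<close> of its block row \<open>i + 1\<close>.\<close>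

lemma shifted_solve_block_recurrence:
  assumes "d \<ge> 1" "E \<in> carrier_mat n s" "C \<in> carrier_mat s s" "D \<in> carrier_mat s s"
    and x: "x \<in> carrier_vec (n * d + s)" and w: "w \<in> carrier_vec (n * d + s)"
    and solve: "(pencil_A n s d P E F C - t \<cdot>\<^sub>m pencil_B n s d P D) *\<^sub>v x = pencil_B n s d P D *\<^sub>v w"
    and i: "1 \<le> i" "Suc i \<le> d"
  shows "vec_block n i x = t \<cdot>\<^sub>v vec_block n (Suc i) x + vec_block n (Suc i) w"
proof (rule eq_vecI)
  let ?A = "pencil_A n s d P E F C" and ?B = "pencil_B n s d P D"
  show "dim_vec (vec_block n i x) = dim_vec (t \<cdot>\<^sub>v vec_block n (Suc i) x + vec_block n (Suc i) w)"
    by (simp add: vec_block_def)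
  fix k assume "k < dim_vec (t \<cdot>\<^sub>v vec_block n (Suc i) x + vec_block n (Suc i) w)"
  then have k: "k < n" by (simp add: vec_block_def)
  define a where "a = i * n + k"
  have a: "n \<le> a" "a < n * d"
    using i k block_index_less[of "Suc i" d k n] by (auto simp: a_def intro: trans_le_add1)
  have an: "a - n = (i - 1) * n + k"
    using i by (cases i) (auto simp: a_def)
  then have index: "(i - Suc 0) * n + k = i * n + k - n"
    by (simp add: a_def)
  have A: "?A \<in> carrier_mat (n * d + s) (n * d + s)" and B: "?B \<in> carrier_mat (n * d + s) (n * d + s)"
    using assms pencil_A_carrier pencil_B_carrier by auto
  have rowA: "row ?A a \<bullet> x = - (x $ (a - n))"
    using a x by (simp add: row_pencil_A[OF assms(1-3)] less_imp_diff_less trans_less_add1)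
  have rowB: "row ?B a \<bullet> y = - (y $ a)" if "y \<in> carrier_vec (n * d + s)" for y
    using a that by (simp add: row_pencil_B[OF assms(4)])
  have "row (?A - t \<cdot>\<^sub>m ?B) a = row ?A a - t \<cdot>\<^sub>v row ?B a"
    using A B a by (intro eq_vecI) auto
  moreover have "row ?A a \<in> carrier_vec (n * d + s)" "row ?B a \<in> carrier_vec (n * d + s)"
    using A B by (auto intro!: carrier_vecI)
  ultimately have "((?A - t \<cdot>\<^sub>m ?B) *\<^sub>v x) $ a = row ?A a \<bullet> x - t * (row ?B a \<bullet> x)"
    using A B a x by (simp add: minus_scalar_prod_distrib[where n = "n * d + s"])
  moreover have "(?B *\<^sub>v w) $ a = row ?B a \<bullet> w"
    using B a by simp
  ultimately have "x $ (a - n) = t * x $ a + w $ a"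
    using solve rowA rowB[OF x] rowB[OF w] by (simp add: algebra_simps)
  then show "vec_block n i x $ k = (t \<cdot>\<^sub>v vec_block n (Suc i) x + vec_block n (Suc i) w) $ k"
    using k by (simp add: vec_block_def index a_def)
qed

text \<open>
  The recurrence expresses a block of \<open>x\<close> by the next one, so only the last block is free; the proof is
  an induction downwards from \<open>d\<close>.
\<close>

lemma shifted_solve_blocks_in_vspan:
  assumes "d \<ge> 1" "E \<in> carrier_mat n s" "C \<in> carrier_mat s s" "D \<in> carrier_mat s s"
    and "x \<in> carrier_vec (n * d + s)" "w \<in> carrier_vec (n * d + s)"
    and "(pencil_A n s d P E F C - t \<cdot>\<^sub>m pencil_B n s d P D) *\<^sub>v x = pencil_B n s d P D *\<^sub>v w"
    and S: "S \<subseteq> carrier_vec n" and last: "vec_block n d x \<in> vspan n S"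
    and w: "\<And>i. i \<in> {1..d} \<Longrightarrow> vec_block n i w \<in> vspan n S"
    and "1 \<le> i" "i \<le> d"
  shows "vec_block n i x \<in> vspan n S"
proof -
  interpret vec_space "TYPE(complex)" n .
  have "1 \<le> i \<longrightarrow> vec_block n i x \<in> vspan n S"
    using \<open>i \<le> d\<close>
  proof (induction rule: inc_induct)
    case base
    then show ?case using last by simp
  next
    case (step i)
    show ?case
    proof
      assume i: "1 \<le> i"
      have "t \<cdot>\<^sub>v vec_block n (Suc i) x \<in> span S"
        using step smult_in_span[OF S] by simp
      moreover have "vec_block n (Suc i) w \<in> span S"
        using step w by simp
      ultimately have "t \<cdot>\<^sub>v vec_block n (Suc i) x + vec_block n (Suc i) w \<in> span S"
        using span_add1[OF S] by simp
      then show "vec_block n i x \<in> span S"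
        using shifted_solve_block_recurrence[OF assms(1-7) i] step by simp
    qed
  qed
  then show ?thesis using \<open>1 \<le> i\<close> by simp
qed

section \<open>The Krylov iteration\<close>

lemma basis_mat_carrier: "basis_mat N u j \<in> carrier_mat N j"
  by (auto simp: basis_mat_def)

lemma set_cols_basis_mat:
  assumes "\<And>k. k \<in> {1..j} \<Longrightarrow> u k \<in> carrier_vec N"
  shows "set (cols (basis_mat N u j)) = u ` {1..j}"
  using assms unfolding basis_mat_def
  by (subst cols_mat_of_cols) (auto simp: atLeastLessThanSuc_atLeastAtMost)

text \<open>
  The form in which a step acts on spans: one shifted linear system, then a linear combination of its
  solution \<open>x\<close> with the earlier basis vectors. Here \<open>h\<close> holds the Gram-Schmidt coefficients
  and \<open>c\<close> is the normalizing factor.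
\<close>

lemma krylov_step:
  assumes kr: "rational_krylov A B \<theta> m u" and A: "A \<in> carrier_mat N N" and B: "B \<in> carrier_mat N N"
    and k: "1 \<le> k" "k < m" and uk: "u k \<in> carrier_vec N"
  obtains x h c where "x \<in> carrier_vec N" "h \<in> carrier_vec k"
    "(A - \<theta> k \<cdot>\<^sub>m B) *\<^sub>v x = B *\<^sub>v u k"
    "u (Suc k) = c \<cdot>\<^sub>v (x - basis_mat N u k *\<^sub>v h)"
proof -
  let ?M = "A - \<theta> k \<cdot>\<^sub>m B"
  define x where "x = minv ?M *\<^sub>v (B *\<^sub>v u k)"
  define h where "h = mat_adjoint (basis_mat N u k) *\<^sub>v x"
  have M: "?M \<in> carrier_mat N N"
    using A B by auto
  have "k \<in> {1..<m}" using k by simp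
  with kr A have inv: "invertible_mat ?M"
    and "\<exists>c. u (k + 1) = c \<cdot>\<^sub>v (x - basis_mat N u k *\<^sub>v h)"
    unfolding rational_krylov_def Let_def x_def h_def by auto
  then obtain c where c: "u (Suc k) = c \<cdot>\<^sub>v (x - basis_mat N u k *\<^sub>v h)"
    by auto
  note I = minv_right_inverse[OF M inv]
  have Bu: "B *\<^sub>v u k \<in> carrier_vec N"
    using B uk by simp
  have x: "x \<in> carrier_vec N"
    using I Bu by (simp add: x_def)
  have h: "h \<in> carrier_vec k"
    using basis_mat_carrier[of N u k] by (intro carrier_vecI) (simp add: h_def mat_adjoint_def)
  have "?M *\<^sub>v x = (?M * minv ?M) *\<^sub>v (B *\<^sub>v u k)"
    unfolding x_def using assoc_mult_mat_vec[OF M I(1) Bu] by simp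
  also have "\<dots> = B *\<^sub>v u k"
    using I Bu by simp
  finally show ?thesis
    using that x h c by blast
qed

text \<open>
  The spanning set starts with the \<open>d\<close> blocks of \<open>u 1\<close> and receives, in each step, the last block of
  the solution of the shifted system. That the basis vectors have the right dimension is
  part of the claim since the step lemma needs it for \<open>u k\<close>.
\<close>

lemma krylov_blocks_spanning_set:
  assumes d: "d \<ge> 1" and E: "E \<in> carrier_mat n s" and C: "C \<in> carrier_mat s s"
    and D: "D \<in> carrier_mat s s"
    and kr: "rational_krylov (pencil_A n s d P E F C) (pencil_B n s d P D) \<theta> m u"
    and "1 \<le> j" "j \<le> m"
  shows "(\<forall>k\<in>{1..j}. u k \<in> carrier_vec (n * d + s)) \<and>
    (\<exists>S. finite S \<and> S \<subseteq> carrier_vec n \<and> card S < d + j \<and>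
      (\<forall>k\<in>{1..j}. \<forall>i\<in>{1..d}. vec_block n i (u k) \<in> vspan n S))"
  using \<open>1 \<le> j\<close> \<open>j \<le> m\<close>
proof (induction j rule: dec_induct)
  case base
  interpret vec_space "TYPE(complex)" n .
  have u: "u 1 \<in> carrier_vec (n * d + s)"
    using kr pencil_A_carrier[OF d E C, of P F] by (simp add: rational_krylov_def)
  let ?S = "(\<lambda>i. vec_block n i (u 1)) ` {1..d}"
  have S: "?S \<subseteq> carrier_vec n" by auto
  have "card ?S < d + 1"
    using card_image_le[of "{1..d}" "\<lambda>i. vec_block n i (u 1)"] by simp
  moreover have "?S \<subseteq> span ?S"
    using S by (rule in_own_span)
  ultimately show ?case
    using u S by (intro conjI exI[of _ ?S]) auto
next
  case (step k)
  interpret vec_space "TYPE(complex)" n .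
  let ?N = "n * d + s"
  have IH: "\<forall>l\<in>{1..k}. u l \<in> carrier_vec ?N"
    using step by simp
  obtain S where S: "finite S" "S \<subseteq> carrier_vec n" "card S < d + k"
    and blocks: "\<And>l i. l \<in> {1..k} \<Longrightarrow> i \<in> {1..d} \<Longrightarrow> vec_block n i (u l) \<in> span S"
    using step by auto
  have uk: "u k \<in> carrier_vec ?N"
    using IH step by simp
  have km: "k < m"
    using step by simp
  obtain x h c where x: "x \<in> carrier_vec ?N" and h: "h \<in> carrier_vec k"
    and solve: "(pencil_A n s d P E F C - \<theta> k \<cdot>\<^sub>m pencil_B n s d P D) *\<^sub>v x
      = pencil_B n s d P D *\<^sub>v u k"
    and u_Suc: "u (Suc k) = c \<cdot>\<^sub>v (x - basis_mat ?N u k *\<^sub>v h)"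
    using krylov_step[OF kr pencil_A_carrier[OF d E C] pencil_B_carrier[OF D] step.hyps(1) km uk]
    by blast
  let ?T = "insert (vec_block n d x) S"
  have T: "?T \<subseteq> carrier_vec n"
    using S by simp
  have mono: "span S \<subseteq> span ?T"
    by (rule span_is_monotone) auto
  have x_in: "vec_block n i x \<in> span ?T" if "i \<in> {1..d}" for i
  proof (rule shifted_solve_blocks_in_vspan[OF d E C D x uk solve T])
    show "vec_block n d x \<in> span ?T"
      using in_own_span[OF T] by simp
    show "vec_block n i (u k) \<in> span ?T" if "i \<in> {1..d}" for i
      using blocks[of k i] that step mono by auto
  qed (use that in auto)
  have Uh: "basis_mat ?N u k *\<^sub>v h \<in> carrier_vec ?N"
    using basis_mat_carrier[of ?N u k] h by simp
  have new: "vec_block n i (u (Suc k)) \<in> span ?T" if i: "i \<in> {1..d}" for i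
  proof -
    have "vec_block n i ` set (cols (basis_mat ?N u k)) \<subseteq> span ?T"
      using set_cols_basis_mat[of k u ?N] IH blocks i mono by auto
    from vec_block_mult_in_vspan[OF basis_mat_carrier i h T this]
    have "(- 1) \<cdot>\<^sub>v vec_block n i (basis_mat ?N u k *\<^sub>v h) \<in> span ?T"
      by (rule smult_in_span[OF T])
    from span_add1[OF T x_in[OF i] this]
    have "vec_block n i x + (- 1) \<cdot>\<^sub>v vec_block n i (basis_mat ?N u k *\<^sub>v h) \<in> span ?T"
      by simp
    moreover have "vec_block n i x - vec_block n i (basis_mat ?N u k *\<^sub>v h)
      = vec_block n i x + (- 1) \<cdot>\<^sub>v vec_block n i (basis_mat ?N u k *\<^sub>v h)"
      by (intro eq_vecI) (auto simp: vec_block_def)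
    ultimately have "vec_block n i x - vec_block n i (basis_mat ?N u k *\<^sub>v h) \<in> span ?T"
      by simp
    then have "c \<cdot>\<^sub>v (vec_block n i x - vec_block n i (basis_mat ?N u k *\<^sub>v h)) \<in> span ?T"
      by (rule smult_in_span[OF T])
    then show ?thesis
      using x Uh i by (simp add: u_Suc vec_block_smult[of _ n d s] vec_block_minus[of _ n d s])
  qed
  have u_carrier: "u (Suc k) \<in> carrier_vec ?N"
    using x Uh by (simp add: u_Suc)
  have "card ?T < d + Suc k"
    using S card_insert_le_m1[of "d + k" S] by (simp add: card_insert_if)
  moreover have "\<forall>l\<in>{1..Suc k}. \<forall>i\<in>{1..d}. vec_block n i (u l) \<in> span ?T"
    using new subsetD[OF mono blocks] by (simp add: atLeastAtMostSuc_conv)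
  moreover have "\<forall>l\<in>{1..Suc k}. u l \<in> carrier_vec ?N"
    using IH u_carrier by (auto simp: le_Suc_eq)
  ultimately show ?case
    using S(1) T by (intro conjI exI[of _ ?T]) auto
qed

theorem theorem3p7:
  fixes n s d m j r :: nat
    and P :: "nat \<Rightarrow> complex mat" and E F C D Q :: "complex mat"
    and \<theta> :: "nat \<Rightarrow> complex" and u :: "nat \<Rightarrow> complex vec"
  assumes "d \<ge> 1"
    and "\<And>i. i \<le> d \<Longrightarrow> P i \<in> carrier_mat n n"
    and "E \<in> carrier_mat n s" and "F \<in> carrier_mat n s"
    and "C \<in> carrier_mat s s" and "D \<in> carrier_mat s s"
    and "det (rational_matrix n d P E F C D) \<noteq> 0"
    and "invertible_mat (P d)" and "invertible_mat D"
    and "minimal_realization n s E F C D"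
    and "rational_krylov (pencil_A n s d P E F C) (pencil_B n s d P D) \<theta> m u"
    and "1 \<le> j" and "j \<le> m"
    and "Q \<in> carrier_mat n r"
    and "mat_adjoint Q * Q = 1\<^sub>m r"
    and "vec_space.rank n Q = r"
    and "mats_span n {Q} = mats_span n ((\<lambda>i. row_block n (basis_mat (n * d + s) u j) i) ` {1..d})"
  shows "r < d + j"
proof -
  interpret vec_space "TYPE(complex)" n .
  let ?N = "n * d + s" and ?U = "basis_mat (n * d + s) u j"
  obtain S where u: "\<And>k. k \<in> {1..j} \<Longrightarrow> u k \<in> carrier_vec ?N"
    and S: "finite S" "S \<subseteq> carrier_vec n" "card S < d + j"
    and blocks: "\<And>k i. k \<in> {1..j} \<Longrightarrow> i \<in> {1..d} \<Longrightarrow> vec_block n i (u k) \<in> span S"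
    using krylov_blocks_spanning_set[OF assms(1,3,5,6,11-13)] by blast
  have "set (cols Q) \<subseteq> span (set (cols Q))"
    using cols_dim[of Q] assms(14) by (intro in_own_span) auto
  also have "\<dots> = mats_span n ((\<lambda>i. row_block n ?U i) ` {1..d})"
    using assms(17) by (simp add: mats_span_def)
  also have "\<dots> \<subseteq> span S"
    unfolding mats_span_def
  proof (rule span_subsetI[OF S(2)])
    show "(\<Union>M\<in>row_block n ?U ` {1..d}. set (cols M)) \<subseteq> span S"
      using set_cols_row_block[OF basis_mat_carrier[of ?N u j]] set_cols_basis_mat[OF u] blocks
      by auto
  qed
  finally have "vec_space.rank n Q \<le> card S"
    by (rule rank_le_card_spanning_set[OF assms(14) S(1,2)])
  then show ?thesis
    using S(3) assms(16) by simp
qed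

end
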